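(* Let $S$ be an Arf numerical semigroup with multiplicity up to five and conductor $s$. Then there exists a row-factorization matrix $\mathrm{RF}(s-1)$ of the Frobenius number $F(S)=s-1$ such that $|\det \mathrm{RF}(s-1)|=s-1$.
   Context: $\mathbb{N}$ denotes the positive integers and $\mathbb{N}_0$ the non-negative integers. A numerical semigroup is a subset $S\subseteq\mathbb{N}_0$ containing $0$, closed under addition, with finite complement in $\mathbb{N}_0$. The multiplicity of $S$ is its smallest nonzero element. The elements of $\mathbb{N}\setminus S$ are the gaps of $S$, and the Frobenius number $F(S)$ is the greatest gap, with $F(S)=-1$ if $S=\mathbb{N}_0$. The conductor of $S$ is $F(S)+1$. $S$ is Arf if $s_2+s_3-s_1\in S$ for all $s_1,s_2,s_3\in S$ with $s_1\le s_2\le s_3$. An integer $z$ is a pseudo-Frobenius number of $S$ if $z\notin S$ and $z+u\in S$ for every nonzero $u\in S$; the Frobenius number is one of these. If $S$ is minimally generated by $n_1<n_2<\dots<n_e$ and $f$ is a pseudo-Frobenius number of $S$, a row-factorization matrix $\mathrm{RF}(f)$ of $f$ is an $e\times e$ matrix $[a_{ij}]$ with $a_{ii}=-1$, $a_{ij}\in\mathbb{N}_0$ for $i\neq j$, and $f=\sum_{j=1}^{e}a_{ij}n_j$ for each $i\in\{1,\dots,e\}$. A pseudo-Frobenius number may have more than one row-factorization matrix.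
   Formalization: The semigroup S = ℕ₀ is excluded: there s = 0, the only row-factorization matrix of F(S) = −1 is [−1], and |det| = 1 is not s − 1 = −1, so the claim as stated fails for it. *)

theory Defs
  imports "Jordan_Normal_Form.Determinant"
begin

definition numerical_semigroup :: "nat set \<Rightarrow> bool" where
  "numerical_semigroup S \<longleftrightarrow>
     0 \<in> S \<and> (\<forall>x\<in>S. \<forall>y\<in>S. x + y \<in> S) \<and> finite (UNIV - S)"

definition multiplicity_sg :: "nat set \<Rightarrow> nat" where
  "multiplicity_sg S = (LEAST x. x \<in> S \<and> x \<noteq> 0)"

definition gaps :: "nat set \<Rightarrow> nat set" where
  "gaps S = {x. 0 < x \<and> x \<notin> S}"

definition frobenius_number :: "nat set \<Rightarrow> int" where
  "frobenius_number S = (if S = UNIV then -1 else int (Max (gaps S)))"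

definition conductor :: "nat set \<Rightarrow> int" where
  "conductor S = frobenius_number S + 1"

text \<open>The natural-number subtraction below never truncates, since \<open>s1 \<le> s2\<close>.\<close>

definition Arf :: "nat set \<Rightarrow> bool" where
  "Arf S \<longleftrightarrow>
     (\<forall>s1\<in>S. \<forall>s2\<in>S. \<forall>s3\<in>S. s1 \<le> s2 \<longrightarrow> s2 \<le> s3 \<longrightarrow> s2 + s3 - s1 \<in> S)"

text \<open>Pseudo-Frobenius numbers are integers because \<open>-1\<close> is one for \<open>UNIV\<close>.\<close>

definition pseudo_frobenius :: "nat set \<Rightarrow> int \<Rightarrow> bool" where
  "pseudo_frobenius S z \<longleftrightarrow>
     z \<notin> int ` S \<and> (\<forall>u\<in>S. u \<noteq> 0 \<longrightarrow> z + int u \<in> int ` S)"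

inductive_set submonoid_generated :: "nat set \<Rightarrow> nat set" for G :: "nat set" where
  zero: "0 \<in> submonoid_generated G"
| gen: "g \<in> G \<Longrightarrow> g \<in> submonoid_generated G"
| add: "x \<in> submonoid_generated G \<Longrightarrow> y \<in> submonoid_generated G \<Longrightarrow>
        x + y \<in> submonoid_generated G"

definition minimally_generated_by :: "nat set \<Rightarrow> nat list \<Rightarrow> bool" where
  "minimally_generated_by S ns \<longleftrightarrow>
     sorted_wrt (<) ns \<and>
     submonoid_generated (set ns) = S \<and>
     (\<forall>G. G \<subset> set ns \<longrightarrow> submonoid_generated G \<noteq> S)"

text \<open>\<open>row_factorization_matrix S f A\<close> says that \<open>A\<close> is a (not necessarily unique)
  row-factorization matrix of the pseudo-Frobenius number \<open>f\<close> of \<open>S\<close>. A numerical semigroup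
  has exactly one minimal system of generators, so the list \<open>ns\<close> is determined by \<open>S\<close>.
  Indices start at 0.\<close>

definition row_factorization_matrix :: "nat set \<Rightarrow> int \<Rightarrow> int mat \<Rightarrow> bool" where
  "row_factorization_matrix S f A \<longleftrightarrow>
     pseudo_frobenius S f \<and>
     (\<exists>ns. minimally_generated_by S ns \<and>
        A \<in> carrier_mat (length ns) (length ns) \<and>
        (\<forall>i<length ns. A $$ (i, i) = -1) \<and>
        (\<forall>i<length ns. \<forall>j<length ns. i \<noteq> j \<longrightarrow> 0 \<le> A $$ (i, j)) \<and>
        (\<forall>i<length ns. f = (\<Sum>j<length ns. A $$ (i, j) * int (ns ! j))))"

end

theory Submission
  imports Defs "HOL-Number_Theory.Cong"
begin

text \<open>
  Let \<open>m\<close> be the multiplicity of \<open>S\<close> and \<open>F\<close> its Frobenius number. If \<open>x\<close> and \<open>y\<close> are nonzero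
  elements of an Arf semigroup, then \<open>x + y - m\<close> is again in it. Hence a nonzero element other than \<open>m\<close>
  is a minimal generator exactly if subtracting \<open>m\<close> from it leaves \<open>S\<close>: the minimal generators are \<open>m\<close>
  and the least elements of \<open>S\<close> in the \<open>m - 1\<close> nonzero residue classes modulo \<open>m\<close>
  (\<open>minimally_generated_min_gens\<close>, \<open>min_gens_eq_apery\<close>).

  Suppose first that \<open>F\<close> is coprime to \<open>m\<close>, and write \<open>w i\<close> for the least element of \<open>S\<close> in the class
  of \<open>i * F\<close>. Then \<open>g 0 = m\<close> and \<open>g i = w i\<close>, for \<open>0 < i < m\<close>, are all minimal generators. Adding \<open>F\<close>
  to a generator leads into the next class, so \<open>F + g i = w (i + 1) + x i * m\<close> with
  \<open>x i \<ge> 0\<close>, where \<open>w m = 0\<close>. These equations are the rows of a row-factorization matrix consisting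
  of \<open>-1\<close> on the diagonal, \<open>1\<close> above it, and the numbers \<open>x i\<close> added to the first column. All other columns
  have sum zero, so up to sign its determinant is the sum of all its entries, that is,
  \<open>(\<Sum>i<m. x i) - 1\<close> (\<open>det_cyclic_mat\<close>). Adding up the \<open>m\<close> equations, the \<open>w i\<close> cancel and
  \<open>m * F + m = (\<Sum>i<m. x i) * m\<close> remains. So the determinant is \<open>F\<close> up to sign
  (\<open>coprime_case\<close>).

  As \<open>F\<close> is never a multiple of \<open>m\<close>, a multiplicity of at most five leaves one other case: \<open>m = 4\<close>
  and \<open>F\<close> even. Every odd number is adjacent to a multiple of \<open>4\<close>, and an Arf semigroup that
  contains two consecutive numbers contains everything beyond them. So no odd number below \<open>F\<close> is
  in \<open>S\<close>, which forces the minimal generators to be \<open>4\<close>, \<open>F + 1\<close>, \<open>F + 3\<close> and \<open>F + 4\<close>, and an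
  explicit four by four matrix works (\<open>multiplicity_four_case\<close>).

  Both matrices are written down for a convenient order of the generators. Passing to the increasing
  order conjugates by a permutation matrix and keeps the determinant
  (\<open>row_factorization_matrix_reindex\<close>).
\<close>

section \<open>Determinants\<close>

text \<open>The sign of the permutation enters once for the rows and once for the columns.\<close>
lemma det_conjugate_permutation:
  fixes A :: "'a :: comm_ring_1 mat"
  assumes A: "A \<in> carrier_mat n n" and p: "p permutes {0..<n}"
  shows "det (mat n n (\<lambda>(i, j). A $$ (p i, p j))) = det A"
proof -
  have p_less: "p i < n" if "i < n" for i
    using permutes_in_image[OF p, of i] that by simp
  define B where "B = mat n n (\<lambda>(i, j). A $$ (p i, j))"
  define C where "C = mat n n (\<lambda>(i, j). transpose_mat B $$ (p i, j))"
  have "det C = signof p * det (transpose_mat B)"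
    unfolding C_def by (rule det_permute_rows[OF _ p]) (simp add: B_def)
  also have "det (transpose_mat B) = signof p * det A"
    using det_permute_rows[OF A p] det_transpose[of B n] by (simp add: B_def)
  finally have "det C = det A"
    by (simp add: sign_def)
  moreover have "mat n n (\<lambda>(i, j). A $$ (p i, p j)) = transpose_mat C"
    by (rule eq_matI) (auto simp: B_def C_def p_less)
  ultimately show ?thesis
    using det_transpose[of C n] by (simp add: C_def)
qed

text \<open>Laplace expansion along the top row, in a form that unfolds matrices of concrete size by
  rewriting.\<close>
lemma det_mat_Suc:
  fixes f :: "nat \<times> nat \<Rightarrow> 'a :: comm_ring_1"
  shows "det (mat (Suc n) (Suc n) f) =
    (\<Sum>j<Suc n. f (0, j) * ((-1) ^ j *
       det (mat n n (\<lambda>(i, k). f (Suc i, if k < j then k else Suc k)))))"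
proof -
  have *: "mat_delete (mat (Suc n) (Suc n) f) 0 j =
      mat n n (\<lambda>(i, k). f (Suc i, if k < j then k else Suc k))" for j
    by (rule eq_matI) (auto simp: mat_delete_def)
  show ?thesis
    by (subst laplace_expansion_row[of _ "Suc n" 0]) (auto simp: cofactor_def * intro!: sum.cong)
qed

lemmas det_mat_numeral = det_mat_Suc[of "pred_numeral k" for k, folded numeral_eq_Suc]

lemma det_four_by_four:
  fixes a b :: "'a :: comm_ring_1"
  shows "det (mat 4 4 (\<lambda>(i, j).
      [[-1, 1, 0, 0], [0, -1, 1, 1], [a, 0, -1, 1], [b, 0, 1, -1]] ! i ! j)) = - (2 * (a + b))"
  by (simp add: det_mat_numeral det_mat_Suc lessThan_nat_numeral)

text \<open>Like a companion matrix, but with the free entries in the first column and the diagonal shifted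
  by \<open>-1\<close>; the shift also applies to the top left entry, which is \<open>x 0 - 1\<close>.\<close>
definition cyclic_mat :: "nat \<Rightarrow> (nat \<Rightarrow> 'a :: comm_ring_1) \<Rightarrow> 'a mat" where
  "cyclic_mat n x = mat n n (\<lambda>(i, j).
     (if j = 0 then x i else 0) - (if j = i then 1 else 0) + (if j = Suc i then 1 else 0))"

text \<open>All columns but the first have sum zero. Replacing the bottom row by the sum of all rows
  therefore leaves a single entry in it, and the complementary minor is triangular with ones on
  the diagonal.\<close>
lemma det_cyclic_mat:
  fixes x :: "nat \<Rightarrow> 'a :: comm_ring_1"
  assumes "0 < n"
  shows "det (cyclic_mat n x) = (-1) ^ (n - 1) * ((\<Sum>i<n. x i) - 1)"
proof -
  obtain k where n: "n = Suc k" using assms by (cases n) auto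
  define A where "A = cyclic_mat n x"
  \<comment> \<open>Multiplication by \<open>L\<close> from the left replaces the bottom row by the sum of all rows.\<close>
  define L :: "'a mat" where "L = mat n n (\<lambda>(i, j). if j = i \<or> i = k then 1 else 0)"
  have carrier: "A \<in> carrier_mat n n" "L \<in> carrier_mat n n" "L * A \<in> carrier_mat n n"
    by (auto simp: A_def L_def cyclic_mat_def)
  have "det L = prod_list (diag_mat L)"
    by (rule det_lower_triangular[of n]) (auto simp: L_def n)
  also have "\<dots> = 1"
    unfolding prod_list_diag_prod by (auto simp: L_def intro!: prod.neutral)
  finally have det_LA: "det (L * A) = det A"
    using det_mult[OF carrier(2,1)] by simp
  have entry: "(L * A) $$ (i, j) = (\<Sum>r<n. (if r = i \<or> i = k then A $$ (r, j) else 0))"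
    if "i < n" "j < n" for i j
    using that carrier by (auto simp: scalar_prod_def L_def lessThan_atLeast0 intro!: sum.cong)
  have upper: "(L * A) $$ (i, j) = A $$ (i, j)" if "i < k" "j < n" for i j
    using that by (simp add: entry n)
  have last: "(L * A) $$ (k, j) = (if j = 0 then (\<Sum>i<n. x i) - 1 else 0)" if "j < n" for j
  proof -
    have "(L * A) $$ (k, j) = (\<Sum>r<n. A $$ (r, j))"
      using that by (simp add: entry n)
    also have "\<dots> = (\<Sum>r<n. (if j = 0 then x r else 0) - (if j = r then 1 else 0)
        + (if j = Suc r then 1 else 0))"
      using that by (intro sum.cong) (auto simp: A_def cyclic_mat_def)
    also have "\<dots> = (if j = 0 then (\<Sum>i<n. x i) else 0) - 1 + (\<Sum>r<n. if j = Suc r then 1 else 0)"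
      using that by (simp add: sum.distrib sum_subtractf)
    also have "(\<Sum>r<n. if j = Suc r then 1 else 0) = (if j = 0 then 0 else 1 :: 'a)"
      using that by (cases j) simp_all
    finally show ?thesis by simp
  qed
  define M where "M = mat_delete (L * A) k 0"
  have M: "M = mat k k (\<lambda>(i, j). A $$ (i, Suc j))"
    unfolding M_def using carrier
    by (intro eq_matI) (auto simp: mat_delete_def n upper simp del: index_mult_mat(1))
  have "det M = prod_list (diag_mat M)"
    by (rule det_lower_triangular[of k]) (auto simp: M A_def cyclic_mat_def n)
  also have "\<dots> = 1"
    unfolding prod_list_diag_prod
    by (auto simp: M A_def cyclic_mat_def n intro!: prod.neutral)
  finally have "cofactor (L * A) k 0 = (-1) ^ k"
    by (simp add: cofactor_def M_def)
  moreover have "det (L * A) = (\<Sum>j<n. (L * A) $$ (k, j) * cofactor (L * A) k j)"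
    by (rule laplace_expansion_row[OF carrier(3)]) (simp add: n)
  moreover have "\<dots> = (\<Sum>j<n. if j = 0 then ((\<Sum>i<n. x i) - 1) * cofactor (L * A) k 0 else 0)"
    by (intro sum.cong) (auto simp: last simp del: index_mult_mat(1))
  moreover have "\<dots> = ((\<Sum>i<n. x i) - 1) * cofactor (L * A) k 0"
    using assms by simp
  ultimately have "det A = ((\<Sum>i<n. x i) - 1) * (-1) ^ k"
    by (simp only: det_LA)
  then show ?thesis
    by (simp add: A_def n mult.commute)
qed


section \<open>Irreducible elements and minimal generation\<close>

lemma submonoid_generated_subset:
  assumes "G \<subseteq> S" "0 \<in> S" "\<And>x y. x \<in> S \<Longrightarrow> y \<in> S \<Longrightarrow> x + y \<in> S"
  shows "submonoid_generated G \<subseteq> S"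
proof
  fix x assume "x \<in> submonoid_generated G"
  then show "x \<in> S" by induction (use assms in auto)
qed

lemma irreducible_in_generators:
  assumes x: "x \<in> submonoid_generated G" and "x \<noteq> 0"
    and irr: "\<And>y z. y \<in> submonoid_generated G \<Longrightarrow> z \<in> submonoid_generated G \<Longrightarrow>
                x = y + z \<Longrightarrow> y = 0 \<or> z = 0"
  shows "x \<in> G"
  using assms
proof (induction rule: submonoid_generated.induct)
  case (add y z)
  then have "y = 0 \<or> z = 0" by blast
  then show ?case
  proof
    assume "y = 0"
    then show ?thesis using add.IH(2) add.prems by simp
  next
    assume "z = 0"
    then show ?thesis using add.IH(1) add.prems by simp
  qed
qed auto

text \<open>Row-factorization matrices are indexed by the increasing list of generators. This lemma
  allows any other enumeration \<open>g\<close> of the generators instead.\<close>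
lemma row_factorization_matrix_reindex:
  fixes A :: "int mat" and g :: "nat \<Rightarrow> nat"
  assumes pf: "pseudo_frobenius S f" and gen: "minimally_generated_by S ns"
    and g: "bij_betw g {..<n} (set ns)"
    and A: "A \<in> carrier_mat n n"
    and diag: "\<And>i. i < n \<Longrightarrow> A $$ (i, i) = -1"
    and nonneg: "\<And>i j. i < n \<Longrightarrow> j < n \<Longrightarrow> i \<noteq> j \<Longrightarrow> 0 \<le> A $$ (i, j)"
    and row: "\<And>i. i < n \<Longrightarrow> f = (\<Sum>j<n. A $$ (i, j) * int (g j))"
  shows "\<exists>B. row_factorization_matrix S f B \<and> det B = det A"
proof -
  have dist: "distinct ns"
    using gen by (auto simp: minimally_generated_by_def strict_sorted_iff)
  then have len: "length ns = n"
    using bij_betw_same_card[OF g] by (simp add: distinct_card)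
  \<comment> \<open>The position in \<open>g\<close> of the \<open>i\<close>-th smallest generator.\<close>
  define p where "p i = (if i < n then inv_into {..<n} g (ns ! i) else i)" for i
  have gp: "g (p i) = ns ! i" if "i < n" for i
    using that g len by (simp add: p_def bij_betw_inv_into_right)
  have bij: "bij_betw p {..<n} {..<n}"
  proof -
    have "bij_betw (inv_into {..<n} g \<circ> (!) ns) {..<n} {..<n}"
      by (rule bij_betw_trans[OF _ bij_betw_inv_into[OF g]])
        (use dist len in \<open>simp add: bij_betw_nth\<close>)
    then show ?thesis
      by (rule bij_betw_cong[THEN iffD1, rotated]) (simp add: p_def)
  qed
  have perm: "p permutes {0..<n}"
    by (rule bij_imp_permutes) (use bij in \<open>auto simp: p_def lessThan_atLeast0\<close>)
  have p_less: "p i < n" if "i < n" for i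
    using bij that by (auto simp: bij_betw_def)
  have p_inj: "p i \<noteq> p j" if "i < n" "j < n" "i \<noteq> j" for i j
    using bij that by (auto simp: bij_betw_def inj_on_def)
  define B where "B = mat n n (\<lambda>(i, j). A $$ (p i, p j))"
  have "f = (\<Sum>j<n. B $$ (i, j) * int (ns ! j))" if i: "i < n" for i
  proof -
    have "f = (\<Sum>j<n. A $$ (p i, j) * int (g j))"
      by (rule row) (rule p_less[OF i])
    also have "\<dots> = (\<Sum>j<n. A $$ (p i, p j) * int (g (p j)))"
      by (rule sum.reindex_bij_betw[OF bij, symmetric])
    finally show ?thesis
      using i by (simp add: B_def gp)
  qed
  then have "row_factorization_matrix S f B"
    unfolding row_factorization_matrix_def
    using pf gen by (intro conjI exI[of _ ns])
      (auto simp: B_def len p_less p_inj diag nonneg)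
  moreover have "det B = det A"
    unfolding B_def by (rule det_conjugate_permutation[OF A perm])
  ultimately show ?thesis by blast
qed


section \<open>Proper Arf semigroups\<close>

locale proper_arf_semigroup =
  fixes S :: "nat set"
  assumes semigroup: "numerical_semigroup S" and arf: "Arf S" and proper: "S \<noteq> UNIV"
begin

definition m :: nat where "m = multiplicity_sg S"

definition F :: nat where "F = Max (gaps S)"

text \<open>Nonzero elements of \<open>S\<close> are at least \<open>m\<close>, so the subtraction does not truncate. In a general
  numerical semigroup this set can be larger than the set of minimal generators; the Arf property
  makes the two equal.\<close>
definition min_gens :: "nat set" where
  "min_gens = {x \<in> S. x \<noteq> 0 \<and> (x = m \<or> x - m \<notin> S)}"

text \<open>The values of this function form the Apery set of \<open>S\<close> with respect to \<open>m\<close>.\<close>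
definition apery :: "nat \<Rightarrow> nat" where
  "apery r = (LEAST x. x \<in> S \<and> [x = r] (mod m))"

lemma zero_in: "0 \<in> S" and add_in: "x \<in> S \<Longrightarrow> y \<in> S \<Longrightarrow> x + y \<in> S"
  using semigroup by (auto simp: numerical_semigroup_def)

lemma finite_gaps: "finite (gaps S)"
  using semigroup by (rule_tac finite_subset[of _ "UNIV - S"]) (auto simp: gaps_def numerical_semigroup_def)

lemma F_gap: "F \<in> gaps S"
proof -
  have "gaps S \<noteq> {}"
    using proper zero_in by (auto simp: gaps_def) (metis gr0I)
  then show ?thesis unfolding F_def by (rule Max_in[OF finite_gaps])
qed

lemma F_pos: "0 < F" and F_notin: "F \<notin> S"
  using F_gap by (auto simp: gaps_def)

lemma above_F: "F < x \<Longrightarrow> x \<in> S"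
  using Max_ge[OF finite_gaps, of x] unfolding F_def[symmetric] by (force simp: gaps_def)

lemma m_in: "m \<in> S" and m_pos: "0 < m" and m_least: "x \<in> S \<Longrightarrow> x \<noteq> 0 \<Longrightarrow> m \<le> x"
proof -
  have ex: "Suc F \<in> S \<and> Suc F \<noteq> 0" using above_F by simp
  show "m \<in> S" "0 < m"
    using LeastI[of "\<lambda>x. x \<in> S \<and> x \<noteq> 0", OF ex] by (auto simp: m_def multiplicity_sg_def)
  show "m \<le> x" if "x \<in> S" "x \<noteq> 0"
    using that unfolding m_def multiplicity_sg_def by (intro Least_le) simp
qed

lemma mult_in: "x \<in> S \<Longrightarrow> t * x \<in> S"
  by (induction t) (auto simp: zero_in add_in)

lemma m_not_dvd_F: "\<not> m dvd F"
  using F_notin mult_in[OF m_in] by (auto simp: dvd_def mult.commute)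

lemma pseudo_frobenius_F: "pseudo_frobenius S (int F)"
  unfolding pseudo_frobenius_def
proof (intro conjI ballI impI)
  show "int F \<notin> int ` S" using F_notin by auto
  show "int F + int u \<in> int ` S" if "u \<in> S" "u \<noteq> 0" for u
    using above_F[of "F + u"] that by (metis imageI less_add_same_cancel1 neq0_conv of_nat_add)
qed

lemma frobenius_number_eq: "frobenius_number S = int F"
  using proper by (simp add: frobenius_number_def F_def)

text \<open>If both summands are nonzero, they are at least \<open>m\<close>, and the Arf property for the triple
  of \<open>m\<close> and the two summands shows that \<open>m\<close> can be subtracted from the sum within \<open>S\<close>.\<close>
lemma min_gens_irreducible:
  assumes "x + y \<in> min_gens" "x \<in> S" "y \<in> S"
  shows "x = 0 \<or> y = 0"
proof (rule ccontr)
  assume nz: "\<not> (x = 0 \<or> y = 0)"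
  then have le: "m \<le> x" "m \<le> y" using m_least assms by auto
  have "x + y - m \<in> S"
  proof (cases "x \<le> y")
    case True
    then show ?thesis using arf m_in assms le unfolding Arf_def by blast
  next
    case False
    then have "y + x - m \<in> S" using arf m_in assms le unfolding Arf_def
      by (meson nat_le_linear)
    then show ?thesis by (simp add: add.commute)
  qed
  moreover have "x + y \<noteq> m" using le m_pos by linarith
  ultimately show False using assms(1) by (simp add: min_gens_def)
qed

text \<open>Subtracting \<open>m\<close> as long as possible ends in a generator or in zero, so \<open>min_gens\<close> generates \<open>S\<close>.
  None of its elements can be omitted, because they are irreducible.\<close>
lemma minimally_generated_min_gens:
  assumes "finite min_gens"
  shows "minimally_generated_by S (sorted_list_of_set min_gens)"
proof -
  have sub: "min_gens \<subseteq> S" by (auto simp: min_gens_def)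
  have m_gen: "m \<in> min_gens" using m_in m_pos by (simp add: min_gens_def)
  have "x \<in> submonoid_generated min_gens" if "x \<in> S" for x
    using that
  proof (induction x rule: less_induct)
    case (less x)
    consider "x = 0" | "x \<in> min_gens" | "x \<noteq> 0" "x - m \<in> S"
      using less.prems by (auto simp: min_gens_def)
    then show ?case
    proof cases
      case 3
      then have "m \<le> x" using m_least less.prems by blast
      then have "x = (x - m) + m" by simp
      moreover have "x - m \<in> submonoid_generated min_gens"
        using 3 m_pos by (intro less.IH) auto
      ultimately show ?thesis
        using submonoid_generated.add submonoid_generated.gen[OF m_gen] by metis
    qed (auto intro: submonoid_generated.intros)
  qed
  then have gen: "submonoid_generated min_gens = S"
    using submonoid_generated_subset[OF sub zero_in add_in] by auto
  have "submonoid_generated G \<noteq> S" if G: "G \<subset> min_gens" for G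
  proof
    assume eq: "submonoid_generated G = S"
    obtain x where x: "x \<in> min_gens" "x \<notin> G" using G by blast
    have "x \<in> G"
    proof (rule irreducible_in_generators)
      show "x \<in> submonoid_generated G" "x \<noteq> 0"
        using x eq by (auto simp: min_gens_def)
    qed (use x eq min_gens_irreducible in auto)
    then show False using x by simp
  qed
  then show ?thesis
    using assms gen by (simp add: minimally_generated_by_def)
qed

lemma exists_row_factorization_matrix:
  fixes A :: "int mat"
  assumes g: "bij_betw g {..<n} min_gens"
    and A: "A \<in> carrier_mat n n"
    and diag: "\<And>i. i < n \<Longrightarrow> A $$ (i, i) = -1"
    and nonneg: "\<And>i j. i < n \<Longrightarrow> j < n \<Longrightarrow> i \<noteq> j \<Longrightarrow> 0 \<le> A $$ (i, j)"
    and row: "\<And>i. i < n \<Longrightarrow> int F = (\<Sum>j<n. A $$ (i, j) * int (g j))"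
  shows "\<exists>B. row_factorization_matrix S (int F) B \<and> det B = det A"
proof (rule row_factorization_matrix_reindex)
  have fin: "finite min_gens" using g by (simp add: bij_betw_finite[symmetric])
  show "minimally_generated_by S (sorted_list_of_set min_gens)"
    by (rule minimally_generated_min_gens[OF fin])
  show "bij_betw g {..<n} (set (sorted_list_of_set min_gens))"
    using g fin by simp
qed (use assms pseudo_frobenius_F in auto)


subsection \<open>Frobenius number coprime to the multiplicity\<close>

lemma apery_in: "apery r \<in> S" and apery_cong: "[apery r = r] (mod m)"
  and apery_le: "x \<in> S \<Longrightarrow> [x = r] (mod m) \<Longrightarrow> apery r \<le> x"
proof -
  \<comment> \<open>Far enough out, every residue class meets \<open>S\<close>.\<close>
  have "F < r + Suc F * m" using m_pos by (cases m) auto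
  then have "r + Suc F * m \<in> S \<and> [r + Suc F * m = r] (mod m)"
    using above_F by (simp add: cong_def del: mult_Suc)
  from LeastI[of "\<lambda>x. x \<in> S \<and> [x = r] (mod m)", OF this]
  show "apery r \<in> S" "[apery r = r] (mod m)" by (auto simp: apery_def)
  show "apery r \<le> x" if "x \<in> S" "[x = r] (mod m)"
    using that unfolding apery_def by (intro Least_le) simp
qed

lemma apery_eq_iff:
  assumes "x \<in> S"
  shows "apery x = x \<longleftrightarrow> x < m \<or> x - m \<notin> S"
proof
  assume eq: "apery x = x"
  show "x < m \<or> x - m \<notin> S"
  proof (rule ccontr)
    assume "\<not> ?thesis"
    then have "x - m \<in> S" "m \<le> x" by auto
    moreover have "[x - m = x] (mod m)" using \<open>m \<le> x\<close> by (simp add: cong_def le_mod_geq)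
    ultimately show False using apery_le[of "x - m" x] eq m_pos by linarith
  qed
next
  assume *: "x < m \<or> x - m \<notin> S"
  show "apery x = x"
  proof (rule ccontr)
    assume "apery x \<noteq> x"
    then have less: "apery x < x" using apery_le[OF assms cong_refl] by simp
    have "[apery x = x] (mod m)" by (rule apery_cong)
    then have "m dvd x - apery x"
      using less by (metis cong_altdef_nat cong_sym less_imp_le)
    then obtain t where t: "x - apery x = t * m" by (metis dvd_def mult.commute)
    with less obtain u where "t = Suc u" by (cases t) auto
    with t less have "x = apery x + u * m + m" by simp
    moreover from this have "apery x + u * m \<in> S"
      using add_in apery_in mult_in[OF m_in] by blast
    ultimately show False using * by (metis add_diff_cancel_right' not_add_less2)
  qed
qed

lemma apery_congI: "[x = y] (mod m) \<Longrightarrow> apery x = apery y"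
  by (simp add: apery_def cong_def)

lemma apery_zero: "m dvd r \<Longrightarrow> apery r = 0"
  using apery_le[OF zero_in, of r] by (auto simp: cong_def)

text \<open>As \<open>F\<close> is a gap, subtracting a positive multiple of \<open>m\<close> from \<open>F + m\<close> leaves \<open>S\<close>. This keeps the
  top left entry of the matrix in the next proof equal to \<open>-1\<close>.\<close>
lemma apery_F: "apery F = F + m"
proof -
  have "apery (F + m) = F + m"
    using apery_eq_iff[of "F + m"] above_F[of "F + m"] m_pos F_notin by simp
  then show ?thesis using apery_congI[of F "F + m"] by (simp add: cong_def)
qed

lemma min_gens_eq_apery: "min_gens = insert m {apery r |r. \<not> m dvd r}"
proof (intro subset_antisym subsetI)
  fix x assume x: "x \<in> min_gens"
  then have xS: "x \<in> S" "x \<noteq> 0" by (auto simp: min_gens_def)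
  show "x \<in> insert m {apery r |r. \<not> m dvd r}"
  proof (cases "x = m")
    case False
    with x have "apery x = x" using apery_eq_iff[OF xS(1)] by (auto simp: min_gens_def)
    moreover from this have "\<not> m dvd x" using apery_zero xS by fastforce
    ultimately show ?thesis by (metis (mono_tags, lifting) insertI2 mem_Collect_eq)
  qed simp
next
  fix x assume "x \<in> insert m {apery r |r. \<not> m dvd r}"
  then consider "x = m" | r where "x = apery r" "\<not> m dvd r" by blast
  then show "x \<in> min_gens"
  proof cases
    case 2
    have "\<not> m dvd x"
      using apery_cong[of r] 2 by (metis cong_dvd_iff)
    then have "x \<noteq> 0" by (metis dvd_0_right)
    moreover have xS: "x \<in> S" using 2 apery_in by simp
    moreover have "apery x = x" using apery_congI[OF apery_cong[of r]] 2 by simp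
    ultimately show ?thesis
      using apery_eq_iff[OF xS] m_least[of x] by (auto simp: min_gens_def)
  qed (use m_in m_pos in \<open>simp add: min_gens_def\<close>)
qed

text \<open>Coprimality makes the multiples of \<open>F\<close> run through all residue classes, so adding \<open>F\<close> permutes
  the generators cyclically up to multiples of \<open>m\<close>.\<close>
lemma coprime_case:
  assumes cop: "coprime F m"
  shows "\<exists>A. row_factorization_matrix S (int F) A \<and> \<bar>det A\<bar> = int F"
proof -
  define w where "w i = apery (i * F)" for i
  \<comment> \<open>The class of zero is represented by the generator \<open>m\<close> in \<open>g\<close>, but by \<open>0\<close> in \<open>w\<close>.\<close>
  define g where "g i = (if i = 0 then m else w i)" for i
  have g_cong: "[g i = i * F] (mod m)" for i
    using apery_cong[of "i * F"] by (simp add: g_def w_def cong_def)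
  have not_dvd: "\<not> m dvd i * F" if "0 < i" "i < m" for i
    using that cop by (metis coprime_commute coprime_dvd_mult_left_iff nat_dvd_not_less)
  have m1: "1 < m" using m_not_dvd_F m_pos by (cases "m = 1") auto

  have bij: "bij_betw g {..<m} min_gens"
    unfolding bij_betw_def
  proof (intro conjI subset_antisym subsetI)
    show "inj_on g {..<m}"
    proof (rule inj_onI)
      fix i j assume ij: "i \<in> {..<m}" "j \<in> {..<m}" "g i = g j"
      then have "[i * F = j * F] (mod m)"
        using g_cong by (metis cong_sym cong_trans)
      then have "[i = j] (mod m)"
        using cop by (simp add: cong_mult_rcancel_nat coprime_commute)
      then show "i = j" using ij by (simp add: cong_def)
    qed
  next
    fix x assume "x \<in> g ` {..<m}"
    then obtain i where i: "i < m" "x = g i" by auto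
    then show "x \<in> min_gens"
      using not_dvd[of i] by (auto simp: g_def w_def min_gens_eq_apery)
  next
    fix x assume "x \<in> min_gens"
    then consider "x = m" | r where "x = apery r" "\<not> m dvd r"
      unfolding min_gens_eq_apery by blast
    then show "x \<in> g ` {..<m}"
    proof cases
      case 1
      then show ?thesis using m_pos by (auto simp: g_def intro!: image_eqI[of _ _ 0])
    next
      case 2
      obtain u where u: "[F * u = 1] (mod m)"
        using cong_solve_coprime_nat[OF cop] by auto
      define i where "i = u * r mod m"
      have "[i * F = F * u * r] (mod m)"
        by (simp add: i_def cong_def mod_mult_left_eq mod_mult_right_eq mult_ac)
      also have "[F * u * r = r] (mod m)"
        using cong_scalar_right[OF u, of r] by simp
      finally have i: "[i * F = r] (mod m)" .
      have "i \<noteq> 0"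
      proof
        assume "i = 0"
        then have "[r = 0] (mod m)" using i by (simp add: cong_sym)
        then show False using 2 by (simp add: cong_0_iff)
      qed
      then have "g i = x" using apery_congI[OF i] 2 by (simp add: g_def w_def)
      moreover have "i < m" using m_pos by (simp add: i_def)
      ultimately show ?thesis by blast
    qed
  qed

  have w_m: "w m = 0" by (simp add: w_def apery_zero)
  have step: "\<exists>t. F + g i = w (Suc i) + t * m" if "i < m" for i
  proof -
    have c: "[F + g i = Suc i * F] (mod m)"
      using cong_add[OF cong_refl[of F] g_cong[of i]] by simp
    have "g i \<in> min_gens" using bij that by (auto simp: bij_betw_def)
    then have "F + g i \<in> S" using above_F by (simp add: min_gens_def)
    then have le: "w (Suc i) \<le> F + g i"
      unfolding w_def by (rule apery_le[OF _ c])
    have "[F + g i = w (Suc i)] (mod m)"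
      using c apery_cong[of "Suc i * F"] unfolding w_def by (metis cong_sym cong_trans)
    then have "m dvd F + g i - w (Suc i)" using le by (simp add: cong_altdef_nat)
    then show ?thesis using le by (metis dvd_def le_add_diff_inverse mult.commute)
  qed
  then obtain x where x: "\<And>i. i < m \<Longrightarrow> F + g i = w (Suc i) + x i * m"
    by metis
  have x0: "x 0 = 0"
    using x[of 0] m_pos apery_F by (simp add: g_def w_def)

  \<comment> \<open>The left-hand sides and the right-hand sides of the equations in \<open>x\<close> are summed separately; the
    generators other than \<open>m\<close> cancel.\<close>
  have "(\<Sum>i<m. g i) = m + (\<Sum>i<m. w (Suc i))"
  proof -
    have "(\<Sum>i<m. g i) = g 0 + (\<Sum>i\<in>{1..<m}. g i)"
      using m_pos by (simp add: lessThan_atLeast0 sum.atLeast_Suc_lessThan)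
    also have "(\<Sum>i\<in>{1..<m}. g i) = (\<Sum>i\<in>{1..<m}. w i)"
      by (intro sum.cong) (auto simp: g_def)
    also have "\<dots> = (\<Sum>i\<in>{1..<Suc m}. w i)"
      using m_pos by (simp add: w_m)
    also have "\<dots> = (\<Sum>i<m. w (Suc i))"
      unfolding lessThan_atLeast0 One_nat_def by (rule sum.shift_bounds_Suc_ivl)
    finally show ?thesis by (simp add: g_def)
  qed
  moreover have "(\<Sum>i<m. F + g i) = (\<Sum>i<m. w (Suc i) + x i * m)"
    by (intro sum.cong) (auto simp: x)
  ultimately have "m * F + m = (\<Sum>i<m. x i) * m"
    by (simp add: sum.distrib sum_distrib_right)
  then have "(F + 1) * m = (\<Sum>i<m. x i) * m" by (simp add: algebra_simps)
  then have sum_x: "(\<Sum>i<m. x i) = F + 1"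
    using m_pos by (metis mult_right_cancel less_irrefl)

  define A where "A = cyclic_mat m (\<lambda>i. int (x i))"
  have entry: "A $$ (i, j) = (if j = 0 then int (x i) else 0) - (if j = i then 1 else 0)
      + (if j = Suc i then 1 else 0)" if "i < m" "j < m" for i j
    using that by (simp add: A_def cyclic_mat_def)
  have row: "int F = (\<Sum>j<m. A $$ (i, j) * int (g j))" if i: "i < m" for i
  proof -
    have "(\<Sum>j<m. A $$ (i, j) * int (g j)) =
        (\<Sum>j<m. (if j = 0 then int (x i) * int (g j) else 0) - (if j = i then int (g j) else 0)
           + (if j = Suc i then int (g j) else 0))"
      using i by (intro sum.cong) (auto simp: entry algebra_simps)
    also have "\<dots> = int (x i) * int m - int (g i) + (if Suc i < m then int (g (Suc i)) else 0)"
      using i by (simp add: sum.distrib sum_subtractf g_def)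
    also have "(if Suc i < m then int (g (Suc i)) else 0) = int (w (Suc i))"
    proof (cases "Suc i < m")
      case False
      then have "Suc i = m" using i by simp
      then show ?thesis using w_m by simp
    qed (simp add: g_def)
    also have "int (x i) * int m - int (g i) + int (w (Suc i)) = int F"
      using x[OF i] by (simp add: algebra_simps flip: of_nat_mult of_nat_add)
    finally show ?thesis by simp
  qed
  have "\<exists>B. row_factorization_matrix S (int F) B \<and> det B = det A"
    by (rule exists_row_factorization_matrix[OF bij _ _ _ row])
      (auto simp: entry x0, simp add: A_def cyclic_mat_def)
  moreover have "\<bar>det A\<bar> = int F"
    using sum_x m_pos by (simp add: A_def det_cyclic_mat abs_mult power_abs flip: of_nat_sum)
  ultimately show ?thesis by metis
qed


subsection \<open>Multiplicity four and even Frobenius number\<close>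

text \<open>An odd number has a multiple of four next to it. Two consecutive elements \<open>a\<close> and \<open>a + 1\<close> yield
  \<open>2 * (a + 1) - a = a + 2\<close> by the Arf property, hence all numbers from \<open>a\<close> on, so \<open>F < a\<close>.\<close>
lemma odd_above_F:
  assumes m: "m = 4" and "even F" and x: "x \<in> S" "odd x"
  shows "F < x"
proof -
  have run: "y \<in> S" if a: "a \<in> S" "Suc a \<in> S" "a \<le> y" for a y
    using \<open>a \<le> y\<close>
  proof (induction y rule: less_induct)
    case (less y)
    show ?case
    proof (cases "y = a \<or> y = Suc a")
      case False
      define z where "z = y - 2"
      have z: "y = Suc (Suc z)" "a \<le> z" using False less.prems by (auto simp: z_def)
      then have "z \<in> S" "Suc z \<in> S" using less.IH by auto
      then have "Suc z + Suc z - z \<in> S"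
        using arf unfolding Arf_def by (meson le_SucI order_refl)
      then show ?thesis using z by simp
    qed (use a in auto)
  qed
  have "x mod 4 = 1 \<or> x mod 4 = 3" using x(2) by presburger
  then show ?thesis
  proof
    assume r: "x mod 4 = 1"
    then have "x = Suc (x div 4 * 4)" by presburger
    moreover have "x div 4 * 4 \<in> S" using mult_in m_in m by metis
    ultimately have "x div 4 * 4 > F"
      using run F_notin x(1) by (metis not_le_imp_less)
    then show ?thesis using \<open>x = Suc (x div 4 * 4)\<close> by linarith
  next
    assume r: "x mod 4 = 3"
    then have "Suc x = (x div 4 + 1) * 4" by presburger
    then have "Suc x \<in> S" using mult_in m_in m by metis
    then show ?thesis using run F_notin x(1) by (metis not_le_imp_less)
  qed
qed

text \<open>Here adding \<open>F\<close> does not reach all classes. The factorization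
  \<open>F + (F + 4) = (F + 1) + (F + 3)\<close> links the class of \<open>F\<close> to the two odd classes, which adding \<open>F\<close>
  exchanges; with \<open>F = 4 * p + 2\<close> the determinant is \<open>- 2 * (p + (p + 1)) = - F\<close>.\<close>
lemma multiplicity_four_case:
  assumes m: "m = 4" and ev: "even F"
  shows "\<exists>A. row_factorization_matrix S (int F) A \<and> \<bar>det A\<bar> = int F"
proof -
  define p where "p = F div 4"
  have F: "F = 4 * p + 2"
    using m_not_dvd_F ev unfolding m p_def by presburger
  have gens: "min_gens = {4, F + 4, F + 1, F + 3}"
  proof (intro subset_antisym subsetI)
    fix x assume x: "x \<in> min_gens"
    then have xS: "x \<in> S" "x \<noteq> 0" "x = 4 \<or> x - 4 \<notin> S" by (auto simp: min_gens_def m)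
    show "x \<in> {4, F + 4, F + 1, F + 3}"
    proof (cases "x = 4")
      case False
      then have "x - 4 \<notin> S" using xS by simp
      then have le: "x \<le> F + 4" using above_F[of "x - 4"] by linarith
      show ?thesis
      proof (cases "even x")
        case True
        have "\<not> 4 dvd x"
        proof
          assume "4 dvd x"
          then obtain t where "x = 4 * t" by blast
          then have "x - 4 = (t - 1) * m" by (simp add: m algebra_simps)
          then show False using \<open>x - 4 \<notin> S\<close> mult_in[OF m_in] by simp
        qed
        then have r: "x mod 4 = 2" using True by presburger
        have "x = F + 4"
        proof (rule ccontr)
          assume "x \<noteq> F + 4"
          then have "x \<le> F" using le r F by presburger
          then have "F = x + (F - x) div 4 * m" using r F m by presburger
          then show False using F_notin add_in[OF xS(1) mult_in[OF m_in]] by metis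
        qed
        then show ?thesis by simp
      next
        case False
        then show ?thesis using odd_above_F[OF m ev xS(1)] le F by simp presburger
      qed
    qed simp
  next
    fix x assume "x \<in> {4, F + 4, F + 1, F + 3}"
    moreover have "F + 1 - 4 \<notin> S" "F + 3 - 4 \<notin> S"
    proof -
      show "F + 3 - 4 \<notin> S" using odd_above_F[OF m ev, of "F + 3 - 4"] F by auto
      \<comment> \<open>No truncation occurs: \<open>F + 1\<close> is a nonzero element of \<open>S\<close>, so it is at least \<open>4\<close>.\<close>
      show "F + 1 - 4 \<notin> S"
        using odd_above_F[OF m ev, of "F + 1 - 4"] F m_least[of "F + 1"] above_F[of "F + 1"] m
        by auto
    qed
    ultimately show "x \<in> min_gens"
      using m_in F_notin above_F by (auto simp: min_gens_def m)
  qed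

  define g where "g i = [4, F + 4, F + 1, F + 3] ! i" for i
  have "distinct [4, F + 4, F + 1, F + 3]" using F by auto
  then have bij: "bij_betw g {..<4} min_gens"
    unfolding g_def gens by (intro bij_betw_nth) auto
  \<comment> \<open>The rows express \<open>F + 4 = (F + 4)\<close>, \<open>F + (F + 4) = (F + 1) + (F + 3)\<close>,
    \<open>F + (F + 1) = p * 4 + (F + 3)\<close> and \<open>F + (F + 3) = (p + 1) * 4 + (F + 1)\<close>.\<close>
  define M :: "int list list" where
    "M = [[-1, 1, 0, 0], [0, -1, 1, 1], [int p, 0, -1, 1], [int p + 1, 0, 1, -1]]"
  define A where "A = mat 4 4 (\<lambda>(i, j). M ! i ! j)"
  have less4: "i < 4 \<longleftrightarrow> i \<in> {0, 1, 2, 3}" for i :: nat by auto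
  have "\<exists>B. row_factorization_matrix S (int F) B \<and> det B = det A"
  proof (rule exists_row_factorization_matrix[OF bij])
    show "A \<in> carrier_mat 4 4" by (simp add: A_def)
    show "A $$ (i, i) = -1" if "i < 4" for i
      using that by (auto simp: A_def M_def less4)
    show "0 \<le> A $$ (i, j)" if "i < 4" "j < 4" "i \<noteq> j" for i j
      using that by (auto simp: A_def M_def less4)
    show "int F = (\<Sum>j<4. A $$ (i, j) * int (g j))" if "i < 4" for i
      using that unfolding less4
      by (auto simp: A_def M_def g_def F eval_nat_numeral)
  qed
  moreover have "det A = - int F"
  proof -
    have "det A = - (2 * (int p + (int p + 1)))"
      unfolding A_def M_def by (rule det_four_by_four)
    then show ?thesis by (simp add: F)
  qed
  ultimately show ?thesis by auto
qed

end

theorem corollary3p12: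
  fixes S :: "nat set" and s :: int
  assumes "numerical_semigroup S"
    and "Arf S"
    and "multiplicity_sg S \<le> 5"
    and "S \<noteq> UNIV"
    and "s = conductor S"
  shows "frobenius_number S = s - 1 \<and>
    (\<exists>A. row_factorization_matrix S (s - 1) A \<and> \<bar>det A\<bar> = s - 1)"
proof -
  interpret proper_arf_semigroup S
    using assms by unfold_locales
  have s: "s - 1 = int F"
    using assms frobenius_number_eq by (simp add: conductor_def)
  have "m \<noteq> 1" using m_not_dvd_F by auto
  then have "m \<in> {2, 3, 4, 5}"
    using assms(3) m_pos unfolding m_def[symmetric] by auto
  then consider "prime m" | "m = 4" "odd F" | "m = 4" "even F" by auto
  then have "\<exists>A. row_factorization_matrix S (int F) A \<and> \<bar>det A\<bar> = int F"
  proof cases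
    case 1
    then show ?thesis
      using m_not_dvd_F prime_imp_coprime[of m F] by (intro coprime_case) (simp add: coprime_commute)
  next
    case 2
    then have "coprime F (2 ^ 2)" by (subst coprime_power_right_iff) simp
    then show ?thesis using 2 coprime_case by simp
  next
    case 3
    then show ?thesis by (rule multiplicity_four_case)
  qed
  then show ?thesis using s frobenius_number_eq by simp
qed

end
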